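(* Let $1<p<\infty$, let $\varepsilon>0$, let $\Omega\subset\mathbb{R}^N$ be a bounded domain, and let $f:\Omega\to\mathbb{R}$ be a bounded Borel measurable function. Let $u,v:\Omega_\varepsilon\to\mathbb{R}$ be two bounded Borel measurable functions such that both $w=u$ and $w=v$ satisfy $$w(x)=\frac12\Big(\sup_{|z|=1}\mathcal{I}^z_\varepsilon w(x)+\inf_{|z|=1}\mathcal{I}^z_\varepsilon w(x)\Big)+\varepsilon^2 f(x)\quad\text{for all }x\in\Omega .$$ If $u\le v$ in $\Omega_\varepsilon\setminus\Omega$, then $u\le v$ in $\Omega$.
   Context: $N\ge 1$ is an integer, $B_1$ is the open unit ball of $\mathbb{R}^N$ centered at the origin, $|B_1|$ its Lebesgue measure. For $\varepsilon>0$, $\Omega_\varepsilon=\{x\in\mathbb{R}^N:\operatorname{dist}(x,\Omega)<\varepsilon\}$. Write $(t)_+^{p-2}=t^{p-2}$ if $t>0$ and $(t)_+^{p-2}=0$ if $t\le 0$. Let $\gamma_{N,p}=\frac{1}{|B_1|}\int_{B_1}(z\cdot h)_+^{p-2}\,dh$, which is finite and independent of the unit vector $z$. For a bounded Borel measurable function $u:\Omega_\varepsilon\to\mathbb{R}$, $x\in\overline\Omega$ and $z\in\mathbb{R}^N$ with $|z|=1$, $$\mathcal{I}^z_\varepsilon u(x)=\frac{1}{\gamma_{N,p}}\cdot\frac{1}{|B_1|}\int_{B_1}u(x+\varepsilon h)\,(z\cdot h)_+^{p-2}\,dh .$$ Suprema and infima over $|z|=1$ are over all unit vectors $z\in\mathbb{R}^N$.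 *)

theory Defs
  imports "HOL-Analysis.Analysis"
begin

definition eps_nbhd :: "real \<Rightarrow> 'a::metric_space set \<Rightarrow> 'a set" where
  "eps_nbhd \<epsilon> \<Omega> = {x. infdist x \<Omega> < \<epsilon>}"

text \<open>\<open>pos_powr t q\<close> is $(t)_+^q$ with the convention that it vanishes for all $t \le 0$,
  also when $q = 0$ or $q < 0$.\<close>
definition pos_powr :: "real \<Rightarrow> real \<Rightarrow> real" where
  "pos_powr t q = (if t > 0 then t powr q else 0)"

definition ball_average :: "(real ^ 'n \<Rightarrow> real) \<Rightarrow> real" where
  "ball_average F = 1 / measure lborel (ball (0 :: real ^ 'n) 1) * (LINT h : ball 0 1 | lborel. F h)"

text \<open>The normalising constant $\gamma_{N,p}$, with $N$ the cardinality of the index type. The unit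
  vector used to compute it is kept as an argument; by \<open>gamma_const_unit_indep\<close> and
  \<open>gamma_const_integrable\<close> below its value does not depend on it, and the integral is finite
  for $p > 1$.\<close>
definition gamma_const :: "real \<Rightarrow> real ^ 'n \<Rightarrow> real" where
  "gamma_const p z = ball_average (\<lambda>h. pos_powr (z \<bullet> h) (p - 2))"

text \<open>The function \<open>u\<close> is total here, but for \<open>x\<close> in the closure of \<open>\<Omega>\<close> only its values on
  \<open>eps_nbhd \<epsilon> \<Omega>\<close> enter.\<close>
definition tilted_average ::
    "real \<Rightarrow> real \<Rightarrow> real ^ 'n \<Rightarrow> (real ^ 'n \<Rightarrow> real) \<Rightarrow> real ^ 'n \<Rightarrow> real" where
  "tilted_average p \<epsilon> z u x =
     1 / gamma_const p z * ball_average (\<lambda>h. u (x + \<epsilon> *\<^sub>R h) * pos_powr (z \<bullet> h) (p - 2))"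

definition solves_dpp ::
    "real \<Rightarrow> real \<Rightarrow> (real ^ 'n) set \<Rightarrow> (real ^ 'n \<Rightarrow> real) \<Rightarrow> (real ^ 'n \<Rightarrow> real) \<Rightarrow> bool" where
  "solves_dpp p \<epsilon> \<Omega> f w \<longleftrightarrow>
     (\<forall>x\<in>\<Omega>. w x = 1 / 2 * ((SUP z\<in>{z. norm z = 1}. tilted_average p \<epsilon> z w x)
                         + (INF z\<in>{z. norm z = 1}. tilted_average p \<epsilon> z w x)) + \<epsilon>\<^sup>2 * f x)"

definition bounded_borel_on :: "'a::topological_space set \<Rightarrow> ('a \<Rightarrow> real) \<Rightarrow> bool" where
  "bounded_borel_on S g \<longleftrightarrow> g \<in> borel_measurable (restrict_space borel S) \<and> bounded (g ` S)"


lemma lborel_distr_orthogonal: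
  fixes T :: "'a::euclidean_space \<Rightarrow> 'a"
  assumes T: "orthogonal_transformation T"
  shows "distr lborel borel T = lborel"
proof -
  define M where "M = distr lborel borel T"
  have linT: "linear T" using T by (rule orthogonal_transformation_linear)
  have [measurable]: "T \<in> borel_measurable borel"
    using linT by (intro borel_measurable_continuous_onI linear_continuous_on)
      (simp add: linear_conv_bounded_linear)
  have sM [measurable_cong, simp]: "sets M = sets borel" by (simp add: M_def)
  have sp [simp]: "space M = UNIV" by (simp add: M_def)
  have surj: "surj T" by (rule orthogonal_transformation_surj[OF T])
  have vball: "T -` ball 0 r = ball 0 r" for r :: real
    using orthogonal_transformation_norm[OF T] by auto
  have Mball: "emeasure M (ball 0 r) = emeasure lborel (ball (0::'a) r)" for r
    by (simp add: M_def emeasure_distr vball)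
  have trans: "emeasure M ((\<lambda>x. x + y) -` A) = emeasure M A" if [measurable]: "A \<in> sets borel" for y A
  proof -
    obtain y' where y': "y = T y'" using surj by (auto simp: surj_def)
    have eq: "T -` ((\<lambda>x. x + y) -` A) = (\<lambda>x. y' + x) -` (T -` A)"
      by (auto simp: y' linear_add[OF linT] add.commute)
    have TA: "T -` A \<in> sets borel"
      using measurable_sets[OF \<open>T \<in> borel_measurable borel\<close> that] by simp
    have "emeasure M ((\<lambda>x. x + y) -` A) = emeasure lborel (T -` ((\<lambda>x. x + y) -` A))"
    proof -
      have "(\<lambda>x. x + y) -` A \<in> sets borel"
        using measurable_sets[of "\<lambda>x. x + y" borel borel A] that by simp
      then show ?thesis by (simp add: M_def emeasure_distr)
    qed
    also have "\<dots> = emeasure (distr lborel borel ((+) y')) (T -` A)"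
      unfolding eq using TA by (simp add: emeasure_distr)
    also have "distr lborel borel ((+) y') = lborel"
      by (simp add: lborel_distr_plus)
    also have "emeasure lborel (T -` A) = emeasure M A"
      by (simp add: M_def emeasure_distr)
    finally show ?thesis .
  qed
  have "sigma_finite_measure M"
  proof
    show "\<exists>A. countable A \<and> A \<subseteq> sets M \<and> \<Union> A = space M \<and> (\<forall>a\<in>A. emeasure M a \<noteq> \<infinity>)"
    proof (intro exI[of _ "range (\<lambda>n::nat. ball 0 (real n))"] conjI)
      show "\<Union> (range (\<lambda>n::nat. ball (0::'a) (real n))) = space M"
        by (auto simp: reals_Archimedean2)
      show "\<forall>a\<in>range (\<lambda>n::nat. ball 0 (real n)). emeasure M a \<noteq> \<infinity>"
        using emeasure_lborel_ball_finite[of "0::'a"] by (auto simp: Mball top.not_eq_extremum)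
    qed auto
  qed
  then interpret M: sigma_finite_measure M .
  interpret P: pair_sigma_finite M lborel ..
  define B where "B = ball (0::'a) 1"
  have [measurable]: "B \<in> sets borel" by (simp add: B_def)
  have MB: "emeasure M B = emeasure lborel B" by (simp add: B_def Mball)
  have main: "emeasure M A * emeasure lborel B = emeasure lborel A * emeasure M B"
    if [measurable]: "A \<in> sets borel" for A
  proof -
    have "emeasure M A * emeasure lborel B
        = (\<integral>\<^sup>+y. emeasure M A * indicator B y \<partial>lborel)"
      by (rule nn_integral_cmult_indicator[symmetric]) simp
    also have "\<dots> = (\<integral>\<^sup>+y. (\<integral>\<^sup>+x. indicator A (x + y) * indicator B y \<partial>M) \<partial>lborel)"
    proof (rule nn_integral_cong)
      fix y
      have m: "(\<lambda>x. x + y) -` A \<in> sets M"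
        using measurable_sets[of "\<lambda>x. x + y" borel borel A] that by simp
      have "(\<integral>\<^sup>+x. indicator A (x + y) * indicator B y \<partial>M)
          = (\<integral>\<^sup>+x. indicator ((\<lambda>x. x + y) -` A) x \<partial>M) * indicator B y"
        by (simp add: nn_integral_multc indicator_def)
      also have "\<dots> = emeasure M A * indicator B y"
        by (simp only: nn_integral_indicator[OF m] trans[OF that])
      finally show "emeasure M A * indicator B y
          = (\<integral>\<^sup>+x. indicator A (x + y) * indicator B y \<partial>M)" by simp
    qed
    also have "\<dots> = (\<integral>\<^sup>+x. (\<integral>\<^sup>+y. indicator A (x + y) * indicator B y \<partial>lborel) \<partial>M)"
      by (rule P.Fubini') measurable
    also have "\<dots> = (\<integral>\<^sup>+x. (\<integral>\<^sup>+y. indicator A y * indicator B (y - x) \<partial>lborel) \<partial>M)"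
    proof (rule nn_integral_cong)
      fix x
      have "(\<integral>\<^sup>+y. indicator A y * indicator B (y - x) \<partial>lborel)
          = (\<integral>\<^sup>+y. indicator A y * indicator B (y - x) \<partial>distr lborel borel ((+) x))"
        by (simp add: lborel_distr_plus)
      also have "\<dots> = (\<integral>\<^sup>+y. indicator A (x + y) * indicator B y \<partial>lborel)"
        by (subst nn_integral_distr) (auto)
      finally show "(\<integral>\<^sup>+y. indicator A (x + y) * indicator B y \<partial>lborel)
          = (\<integral>\<^sup>+y. indicator A y * indicator B (y - x) \<partial>lborel)" by simp
    qed
    also have "\<dots> = (\<integral>\<^sup>+y. (\<integral>\<^sup>+x. indicator A y * indicator B (y - x) \<partial>M) \<partial>lborel)"
      by (rule P.Fubini'[symmetric]) measurable
    also have "\<dots> = (\<integral>\<^sup>+y. indicator A y * emeasure M B \<partial>lborel)"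
    proof (rule nn_integral_cong)
      fix y
      have m: "(\<lambda>x. x + - y) -` B \<in> sets M"
        using measurable_sets[of "\<lambda>x. x + - y" borel borel B] by simp
      have "(\<integral>\<^sup>+x. indicator A y * indicator B (y - x) \<partial>M)
          = (\<integral>\<^sup>+x. indicator A y * indicator ((\<lambda>x. x + - y) -` B) x \<partial>M)"
        by (simp add: indicator_def B_def norm_minus_commute)
      also have "\<dots> = indicator A y * (\<integral>\<^sup>+x. indicator ((\<lambda>x. x + - y) -` B) x \<partial>M)"
        using m by (intro nn_integral_cmult) auto
      also have "\<dots> = indicator A y * emeasure M B"
        by (simp only: nn_integral_indicator[OF m] trans[OF \<open>B \<in> sets borel\<close>])
      finally show "(\<integral>\<^sup>+x. indicator A y * indicator B (y - x) \<partial>M)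
          = indicator A y * emeasure M B" .
    qed
    also have "\<dots> = emeasure lborel A * emeasure M B"
      by (simp add: nn_integral_multc)
    finally show ?thesis .
  qed
  have pos: "emeasure lborel B \<noteq> 0"
    using content_ball_pos[of 1 "0::'a"] by (auto simp: B_def measure_def)
  have fin: "emeasure lborel B \<noteq> top"
    using emeasure_lborel_ball_finite[of "0::'a" 1] by (simp add: B_def)
  have "M = lborel"
  proof (rule measure_eqI)
    fix A assume "A \<in> sets M"
    then have "emeasure M A * emeasure lborel B = emeasure lborel A * emeasure lborel B"
      using main[of A] by (simp add: MB)
    then show "emeasure M A = emeasure lborel A"
      using pos fin by (metis ennreal_mult_divide_eq)
  qed simp
  then show ?thesis by (simp add: M_def)
qed

lemma pos_powr_measurable [measurable]:
  assumes [measurable]: "g \<in> borel_measurable M"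
  shows "(\<lambda>x. pos_powr (g x) q) \<in> borel_measurable M"
  unfolding pos_powr_def by measurable

lemma gamma_const_unit_indep:
  fixes z z' :: "real ^ 'n"
  assumes "norm z = 1" "norm z' = 1"
  shows "gamma_const p z = gamma_const p z'"
proof -
  obtain T :: "real ^ 'n \<Rightarrow> real ^ 'n" where T: "orthogonal_transformation T" "T z = z'"
    using orthogonal_transformation_exists_1 assms by metis
  have inner: "z' \<bullet> T h = z \<bullet> h" for h
    using T by (metis orthogonal_transformation_def)
  have [measurable]: "T \<in> borel_measurable borel"
    using orthogonal_transformation_linear[OF T(1)]
    by (intro borel_measurable_continuous_onI linear_continuous_on)
      (simp add: linear_conv_bounded_linear)
  have "(LINT h : ball 0 1 | lborel. pos_powr (z' \<bullet> h) (p - 2))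
      = (LINT h : ball 0 1 | distr lborel borel T. pos_powr (z' \<bullet> h) (p - 2))"
    by (simp add: lborel_distr_orthogonal[OF T(1)])
  also have "\<dots> = (LINT h : ball 0 1 | lborel. pos_powr (z \<bullet> h) (p - 2))"
    unfolding set_lebesgue_integral_def
    by (subst integral_distr)
      (auto simp: inner indicator_def orthogonal_transformation_norm[OF T(1)])
  finally show ?thesis
    by (simp add: gamma_const_def ball_average_def)
qed

lemma gamma_const_integrable:
  fixes z :: "real ^ 'n"
  assumes z: "norm z = 1" and p: "1 < p"
  shows "set_integrable lborel (ball 0 1) (\<lambda>h. pos_powr (z \<bullet> h) (p - 2))"
proof -
  obtain e :: "real ^ 'n" where e: "e \<in> Basis" using nonempty_Basis by blast
  obtain T :: "real ^ 'n \<Rightarrow> real ^ 'n" where T: "orthogonal_transformation T" "T z = e"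
    using orthogonal_transformation_exists_1 z norm_Basis[OF e] by metis
  have inner: "e \<bullet> T h = z \<bullet> h" for h
    using T by (metis orthogonal_transformation_def)
  have [measurable]: "T \<in> borel_measurable borel"
    using orthogonal_transformation_linear[OF T(1)]
    by (intro borel_measurable_continuous_onI linear_continuous_on)
      (simp add: linear_conv_bounded_linear)
  define g where "g b t = (if b = e then ennreal (indicator {0..1} t * t powr (p - 2))
      else indicator {-1..1} t)" for b :: "real ^ 'n" and t :: real
  have g_meas [measurable]: "g b \<in> borel_measurable borel" for b
    unfolding g_def by (cases "b = e") auto
  have "(\<lambda>t::real. t powr (p - 2)) absolutely_integrable_on {0..1}"
    using integrable_on_powr_from_0[of "p - 2" 1] p
    by (intro nonnegative_absolutely_integrable_1) auto
  then have "integrable lborel (\<lambda>t::real. indicator {0..1} t * t powr (p - 2))"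
    unfolding set_integrable_def by (subst (asm) integrable_completion) auto
  then have ge: "(\<integral>\<^sup>+t. g e t \<partial>lborel) < \<infinity>"
    by (simp add: g_def integrable_iff_bounded ennreal_indicator abs_mult)
  have gb: "(\<integral>\<^sup>+t. g b t \<partial>lborel) < \<infinity>" if "b \<noteq> e" for b
    using that by (simp add: g_def)
  have fin: "(\<integral>\<^sup>+h. (\<Prod>b\<in>Basis. g b (h \<bullet> b)) \<partial>lborel) < \<infinity>"
  proof (subst nn_integral_lborel_prod)
    have "(\<integral>\<^sup>+t. g b t \<partial>lborel) \<noteq> top" for b
      using ge gb by (cases "b = e") (auto simp: less_top)
    then show "(\<Prod>b\<in>Basis. \<integral>\<^sup>+t. g b t \<partial>lborel) < \<infinity>"
      by (simp add: ennreal_prod_eq_top less_top[symmetric])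
  qed auto
  have le: "ennreal (indicator (ball 0 1) h * pos_powr (e \<bullet> h) (p - 2)) \<le> (\<Prod>b\<in>Basis. g b (h \<bullet> b))"
    for h :: "real ^ 'n"
  proof (cases "h \<in> ball 0 1 \<and> e \<bullet> h > 0")
    case False
    then show ?thesis by (auto simp: pos_powr_def)
  next
    case True
    have le1: "\<bar>h \<bullet> b\<bar> \<le> 1" if "b \<in> Basis" for b
      using Basis_le_norm[OF that, of h] True by auto
    have "(\<Prod>b\<in>Basis. g b (h \<bullet> b)) = g e (h \<bullet> e) * (\<Prod>b\<in>Basis - {e}. g b (h \<bullet> b))"
      using e by (simp add: prod.remove)
    also have "(\<Prod>b\<in>Basis - {e}. g b (h \<bullet> b)) = 1"
      using le1 by (intro prod.neutral) (auto simp: g_def abs_le_iff indicator_def)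
    finally show ?thesis
      using True le1[OF e] by (simp add: g_def pos_powr_def inner_commute)
  qed
  let ?G = "\<lambda>h. indicator (ball 0 1) h * pos_powr (e \<bullet> h) (p - 2)"
  have G: "?G \<in> borel_measurable borel"
    by (intro borel_measurable_times borel_measurable_indicator pos_powr_measurable) auto
  have "integrable lborel ?G"
  proof (rule integrableI_bounded)
    have nn: "norm (indicator (ball 0 1) h * pos_powr (e \<bullet> h) (p - 2))
        = indicator (ball 0 1) h * pos_powr (e \<bullet> h) (p - 2)" for h
      by (simp add: pos_powr_def indicator_def)
    show "(\<integral>\<^sup>+h. ennreal (norm (indicator (ball 0 1) h * pos_powr (e \<bullet> h) (p - 2))) \<partial>lborel) < \<infinity>"
      unfolding nn by (rule le_less_trans[OF nn_integral_mono fin]) (rule le)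
    show "?G \<in> borel_measurable lborel" using G by simp
  qed
  then have "integrable (distr lborel borel T) ?G"
    by (simp add: lborel_distr_orthogonal[OF T(1)])
  then have "integrable lborel (\<lambda>h. indicator (ball 0 1) (T h) * pos_powr (e \<bullet> T h) (p - 2))"
    using G by (subst (asm) integrable_distr_eq) auto
  then show ?thesis
    by (simp add: set_integrable_def inner indicator_def orthogonal_transformation_norm[OF T(1)])
qed

end

theory Submission
  imports Defs
begin

text \<open>The tilted averages are jointly continuous in direction and base point, so the difference
  of the two equations extends \<open>u - v\<close> from \<open>\<Omega>\<close> to a continuous function on
  \<open>closure \<Omega>\<close>, and suprema over directions are attained. If the maximum \<open>M\<close> of this function is
  positive, take a maximum point \<open>x\<close> that is extreme in a direction \<open>e\<close>. There a maximising
  direction for \<open>u\<close> must satisfy \<open>u - v = M\<close> almost everywhere on the corresponding half ball,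
  which therefore consists of maximum points; by extremality the direction is \<open>- e\<close>. The same
  holds for a minimising direction for \<open>v\<close>. But then the supremum and the infimum of the averages
  of \<open>u\<close> at \<open>x\<close> agree, so \<open>e\<close> is a maximising direction as well, a contradiction.\<close>

section \<open>Null sets, suprema over compact families, integrability\<close>

text \<open>A nonempty open set is not negligible. This turns the almost everywhere equality
  obtained from an integral into an actual point.\<close>

lemma AE_lborel_imp_ex_in_open:
  fixes U :: "'a::euclidean_space set"
  assumes "AE x in lborel. P x" "open U" "U \<noteq> {}"
  shows "\<exists>x\<in>U. P x"
proof (rule ccontr)
  assume neg: "\<not> (\<exists>x\<in>U. P x)"
  have "AE x in lebesgue. x \<notin> U"
    using AE_completion[OF assms(1)] by eventually_elim (use neg in blast)
  then have "negligible U"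
    using assms(2) by (simp add: negligible_iff_null_sets AE_iff_null_sets)
  then show False
    using open_not_negligible[OF assms(2,3)] by simp
qed

text \<open>On the compact product \<open>g\<close> is uniformly continuous, so the functions
  \<open>g z\<close> share one modulus of continuity, and their supremum inherits it.\<close>

lemma continuous_on_SUP_compact:
  fixes g :: "'z::metric_space \<Rightarrow> 'x::metric_space \<Rightarrow> real"
  assumes Z: "compact Z" "Z \<noteq> {}" and X: "compact X"
    and cont: "continuous_on (Z \<times> X) (\<lambda>(z, x). g z x)"
  shows "continuous_on X (\<lambda>x. SUP z\<in>Z. g z x)"
proof -
  have uc: "uniformly_continuous_on (Z \<times> X) (\<lambda>(z, x). g z x)"
    using cont by (rule compact_uniformly_continuous) (intro compact_Times Z X)
  have bdd: "bdd_above ((\<lambda>z. g z x) ` Z)" if "x \<in> X" for x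
  proof -
    have "continuous_on Z (\<lambda>z. g z x)"
      using continuous_on_compose2[OF cont, of Z "\<lambda>z. (z, x)"] that
      by (simp add: continuous_on_Pair image_subset_iff)
    then show ?thesis
      using Z by (intro bounded_imp_bdd_above compact_imp_bounded compact_continuous_image)
  qed
  show ?thesis
    unfolding continuous_on_iff
  proof (intro ballI allI impI)
    fix x and e :: real
    assume x: "x \<in> X" and e: "0 < e"
    obtain d where d: "0 < d" and
      close: "\<And>q q'. q \<in> Z \<times> X \<Longrightarrow> q' \<in> Z \<times> X \<Longrightarrow> dist q' q < d \<Longrightarrow>
        dist (case q' of (z, x) \<Rightarrow> g z x) (case q of (z, x) \<Rightarrow> g z x) < e / 2"
      using uc e unfolding uniformly_continuous_on_def by (metis half_gt_zero)
    \<comment> \<open>Passing to the supremum keeps only a weak inequality, hence the modulus was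
      taken for \<open>e / 2\<close>.\<close>
    have le: "(SUP z\<in>Z. g z y) \<le> (SUP z\<in>Z. g z y') + e / 2"
      if "y \<in> X" "y' \<in> X" "dist y y' < d" for y y'
    proof (rule cSUP_least[OF Z(2)])
      fix z assume z: "z \<in> Z"
      have "dist (g z y) (g z y') < e / 2"
        using close[of "(z, y')" "(z, y)"] z that by (simp add: dist_Pair_Pair)
      then have "g z y \<le> g z y' + e / 2" unfolding dist_real_def by linarith
      also have "g z y' \<le> (SUP z\<in>Z. g z y')"
        by (rule cSUP_upper[OF z bdd[OF that(2)]])
      finally show "g z y \<le> (SUP z\<in>Z. g z y') + e / 2" by simp
    qed
    show "\<exists>d>0. \<forall>x'\<in>X. dist x' x < d \<longrightarrow> dist (SUP z\<in>Z. g z x') (SUP z\<in>Z. g z x) < e"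
    proof (intro exI[of _ d] conjI ballI impI d)
      fix x' assume x': "x' \<in> X" "dist x' x < d"
      then show "dist (SUP z\<in>Z. g z x') (SUP z\<in>Z. g z x) < e"
        using le[of x' x] le[of x x'] x e by (auto simp: dist_real_def dist_commute abs_less_iff)
    qed
  qed
qed

lemma continuous_on_INF_compact:
  fixes g :: "'z::metric_space \<Rightarrow> 'x::metric_space \<Rightarrow> real"
  assumes "compact Z" "Z \<noteq> {}" "compact X" "continuous_on (Z \<times> X) (\<lambda>(z, x). g z x)"
  shows "continuous_on X (\<lambda>x. INF z\<in>Z. g z x)"
proof -
  have "continuous_on X (\<lambda>x. - (SUP z\<in>Z. - g z x))"
    by (intro continuous_on_minus continuous_on_SUP_compact assms)
      (use continuous_on_minus[OF assms(4)] in \<open>simp add: case_prod_unfold\<close>)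
  then show ?thesis
    by (simp add: Inf_real_def image_image)
qed

lemma integrable_bounded_mult:
  fixes w k :: "'a \<Rightarrow> real"
  assumes k: "integrable M k" and w: "w \<in> borel_measurable M" "\<And>x. \<bar>w x\<bar> \<le> B"
  shows "integrable M (\<lambda>x. w x * k x)"
proof (rule Bochner_Integration.integrable_bound)
  show "integrable M (\<lambda>x. B * k x)" using k by simp
  show "(\<lambda>x. w x * k x) \<in> borel_measurable M" using k w(1) by simp
  show "AE x in M. norm (w x * k x) \<le> norm (B * k x)"
    using order_trans[OF w(2) abs_ge_self] by (intro AE_I2) (simp add: abs_mult mult_right_mono)
qed

section \<open>The truncated power kernel and its mass\<close>

text \<open>With the indicator of the ball built in, every integral runs over the whole space, where
  the kernel can be translated freely.\<close>

definition tilt_kernel :: "real \<Rightarrow> real ^ 'n \<Rightarrow> real ^ 'n \<Rightarrow> real" where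
  "tilt_kernel p z h = indicator (ball 0 1) h * pos_powr (z \<bullet> h) (p - 2)"

lemma tilt_kernel_measurable [measurable]: "tilt_kernel p z \<in> borel_measurable borel"
proof -
  have "(\<lambda>h. indicator (ball 0 1) h * pos_powr (z \<bullet> h) (p - 2)) \<in> borel_measurable borel"
    by (intro borel_measurable_times borel_measurable_indicator pos_powr_measurable) auto
  then show ?thesis unfolding tilt_kernel_def[abs_def] .
qed

lemma tilt_kernel_nonneg: "0 \<le> tilt_kernel p z h"
  by (simp add: tilt_kernel_def pos_powr_def)

lemma tilt_kernel_pos_iff: "0 < tilt_kernel p z h \<longleftrightarrow> norm h < 1 \<and> 0 < z \<bullet> h"
  by (auto simp: tilt_kernel_def pos_powr_def indicator_def)

lemma tilt_kernel_integrable: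
  assumes "norm z = 1" "1 < p"
  shows "integrable lborel (tilt_kernel p z)"
  using gamma_const_integrable[OF assms]
  by (simp add: tilt_kernel_def[abs_def] set_integrable_def)

lemma gamma_const_eq_tilt_kernel:
  "gamma_const p z = 1 / measure lborel (ball (0 :: real ^ 'n) 1) * (LINT h|lborel. tilt_kernel p z h)"
  for z :: "real ^ 'n"
  by (simp add: gamma_const_def ball_average_def tilt_kernel_def set_lebesgue_integral_def)

lemma measure_unit_ball_pos: "0 < measure lborel (ball (0 :: real ^ 'n) 1)"
  using content_ball_pos[of 1 "0 :: real ^ 'n"] by simp

text \<open>Inherited from the rotation invariance behind \<open>gamma_const_unit_indep\<close>. It
  gives all averages one common denominator and supplies the equal masses for Scheffe's
  lemma.\<close>

lemma tilt_kernel_integral_indep: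
  fixes z z' :: "real ^ 'n"
  assumes "norm z = 1" "norm z' = 1"
  shows "(LINT h|lborel. tilt_kernel p z h) = (LINT h|lborel. tilt_kernel p z' h)"
  using gamma_const_unit_indep[OF assms, of p] measure_unit_ball_pos[where 'n = 'n]
  by (simp add: gamma_const_eq_tilt_kernel)

lemma open_half_balls: "open {h :: 'a::real_inner. norm h < 1 \<and> 0 < z \<bullet> h \<and> 0 < e \<bullet> h}"
  by (intro open_Collect_conj open_Collect_less continuous_intros)

text \<open>Only the half ball of \<open>- e\<close> can miss that of \<open>e\<close>; this is what
  later singles out the direction \<open>- e\<close>.\<close>

lemma half_balls_nonempty:
  fixes z e :: "'a::real_inner"
  assumes "norm z = 1" "norm e = 1" "z \<noteq> - e"
  shows "{h. norm h < 1 \<and> 0 < z \<bullet> h \<and> 0 < e \<bullet> h} \<noteq> {}"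
proof -
  have zz: "z \<bullet> z = 1" "e \<bullet> e = 1"
    using assms by (simp_all add: dot_square_norm)
  \<comment> \<open>The witness is a multiple of \<open>z + e\<close>, whose inner products with
    \<open>z\<close> and \<open>e\<close> both equal \<open>1 + z \<bullet> e\<close>, half its
    squared norm. The factor 1/3 brings the norm down to at most 2/3.\<close>
  have "0 < (z + e) \<bullet> (z + e)"
    using assms(3) by (simp add: eq_neg_iff_add_eq_0)
  then have "0 < 1 + z \<bullet> e"
    by (simp add: inner_add zz inner_commute)
  moreover have "norm ((1/3) *\<^sub>R (z + e)) < 1"
    using norm_triangle_ineq[of z e] assms by simp
  ultimately have "(1/3) *\<^sub>R (z + e) \<in> {h. norm h < 1 \<and> 0 < z \<bullet> h \<and> 0 < e \<bullet> h}"
    by (simp add: inner_add zz inner_commute)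
  then show ?thesis by blast
qed

text \<open>The kernel is positive exactly on the open half ball of \<open>z\<close>, which meets
  that of \<open>e\<close> in a nonempty open set; some point there satisfies the almost everywhere
  property.\<close>

lemma AE_tilt_kernel_imp_ex:
  fixes z e :: "real ^ 'n"
  assumes "AE h in lborel. tilt_kernel p z h > 0 \<longrightarrow> P h" "norm z = 1" "norm e = 1" "z \<noteq> - e"
  shows "\<exists>h. norm h < 1 \<and> 0 < e \<bullet> h \<and> P h"
  using AE_lborel_imp_ex_in_open[OF assms(1) open_half_balls half_balls_nonempty[OF assms(2-4)]]
  by (auto simp: tilt_kernel_pos_iff)

lemma tilt_kernel_integral_pos:
  fixes z :: "real ^ 'n"
  assumes z: "norm z = 1" and p: "1 < p"
  shows "0 < (LINT h|lborel. tilt_kernel p z h)"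
proof -
  have "\<not> (AE h in lborel. tilt_kernel p z h = 0)"
  proof
    assume "AE h in lborel. tilt_kernel p z h = 0"
    then have vanish: "AE h in lborel. tilt_kernel p z h > 0 \<longrightarrow> False"
      by eventually_elim simp
    \<comment> \<open>This allows \<open>e = z\<close> in the previous lemma, which then yields a
      point satisfying \<open>False\<close>.\<close>
    have "z \<noteq> - z"
    proof
      assume "z = - z"
      then have "z \<bullet> z = - (z \<bullet> z)" by (metis inner_minus_right)
      then show False using z by (simp add: dot_square_norm)
    qed
    then show False
      using AE_tilt_kernel_imp_ex[OF vanish z z] by simp
  qed
  then have "(LINT h|lborel. tilt_kernel p z h) \<noteq> 0"
    using integral_nonneg_eq_0_iff_AE[OF tilt_kernel_integrable[OF z p]]
    by (simp add: tilt_kernel_nonneg)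
  moreover have "0 \<le> (LINT h|lborel. tilt_kernel p z h)"
    by (simp add: tilt_kernel_nonneg)
  ultimately show ?thesis by simp
qed

section \<open>Tilted averages as weighted means\<close>

text \<open>The volume of the ball cancels between the average and \<open>gamma_const\<close>,
  leaving a mean of \<open>w\<close> weighted by the kernel.\<close>

lemma tilted_average_eq:
  fixes z :: "real ^ 'n"
  shows "tilted_average p \<epsilon> z w x
    = (LINT h|lborel. w (x + \<epsilon> *\<^sub>R h) * tilt_kernel p z h) / (LINT h|lborel. tilt_kernel p z h)"
proof -
  have "(LINT h : ball 0 1 | lborel. w (x + \<epsilon> *\<^sub>R h) * pos_powr (z \<bullet> h) (p - 2))
      = (LINT h|lborel. w (x + \<epsilon> *\<^sub>R h) * tilt_kernel p z h)"
    by (simp add: set_lebesgue_integral_def tilt_kernel_def mult.left_commute)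
  then show ?thesis
    using measure_unit_ball_pos[where 'n = 'n]
    by (simp add: tilted_average_def gamma_const_eq_tilt_kernel ball_average_def)
qed

lemma tilted_average_cong:
  assumes "\<And>h. norm h < 1 \<Longrightarrow> w (x + \<epsilon> *\<^sub>R h) = w' (x + \<epsilon> *\<^sub>R h)"
  shows "tilted_average p \<epsilon> z w x = tilted_average p \<epsilon> z w' x"
  unfolding tilted_average_eq
  by (intro arg_cong2[where f = "(/)"] Bochner_Integration.integral_cong refl)
    (use assms in \<open>auto simp: tilt_kernel_def indicator_def\<close>)

lemma tilted_integrand_integrable:
  fixes w :: "real ^ 'n \<Rightarrow> real"
  assumes "w \<in> borel_measurable borel" "\<And>y. \<bar>w y\<bar> \<le> B" and "norm z = 1" "1 < p"
  shows "integrable lborel (\<lambda>h. w (x + \<epsilon> *\<^sub>R h) * tilt_kernel p z h)"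
  by (rule integrable_bounded_mult[where B = B]) (use assms in \<open>simp_all add: tilt_kernel_integrable\<close>)

lemma tilted_average_diff:
  fixes u v :: "real ^ 'n \<Rightarrow> real"
  assumes "u \<in> borel_measurable borel" "\<And>y. \<bar>u y\<bar> \<le> B"
    and "v \<in> borel_measurable borel" "\<And>y. \<bar>v y\<bar> \<le> B" and "norm z = 1" "1 < p"
  shows "tilted_average p \<epsilon> z (\<lambda>y. u y - v y) x = tilted_average p \<epsilon> z u x - tilted_average p \<epsilon> z v x"
  unfolding tilted_average_eq left_diff_distrib
  using tilted_integrand_integrable[OF assms(1,2,5,6)] tilted_integrand_integrable[OF assms(3,4,5,6)]
  by (simp add: diff_divide_distrib)

text \<open>The integral of \<open>(M - w) * K\<close> is \<open>M\<close> minus the average, times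
  the positive mass of the kernel \<open>K\<close>. Its integrand is nonnegative, so in the equality
  case it vanishes almost everywhere.\<close>

lemma tilted_average_le:
  fixes w :: "real ^ 'n \<Rightarrow> real"
  assumes w: "w \<in> borel_measurable borel" "\<And>y. \<bar>w y\<bar> \<le> B" and z: "norm z = 1" and p: "1 < p"
    and le: "\<And>h. norm h < 1 \<Longrightarrow> w (x + \<epsilon> *\<^sub>R h) \<le> M"
  shows "tilted_average p \<epsilon> z w x \<le> M"
    and "M \<le> tilted_average p \<epsilon> z w x \<Longrightarrow>
      AE h in lborel. tilt_kernel p z h > 0 \<longrightarrow> w (x + \<epsilon> *\<^sub>R h) = M"
proof -
  let ?K = "tilt_kernel p z"
  let ?F = "\<lambda>h. M * ?K h - w (x + \<epsilon> *\<^sub>R h) * ?K h"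
  note int = tilted_integrand_integrable[OF w z p, of x \<epsilon>] tilt_kernel_integrable[OF z p]
  note pos = tilt_kernel_integral_pos[OF z p]
  \<comment> \<open>The bound on \<open>w\<close> is available only inside the unit ball; outside it
    the kernel is zero.\<close>
  have nn: "0 \<le> ?F h" for h
    using mult_right_mono[OF le tilt_kernel_nonneg, of h p z h]
    by (cases "norm h < 1") (simp_all add: tilt_kernel_def)
  have F: "integrable lborel ?F" using int by simp
  have eq: "(LINT h|lborel. ?F h)
      = (M - tilted_average p \<epsilon> z w x) * (LINT h|lborel. ?K h)"
    using int pos by (simp add: tilted_average_eq left_diff_distrib)
  have "0 \<le> (LINT h|lborel. ?F h)" using nn by simp
  then show 1: "tilted_average p \<epsilon> z w x \<le> M"
    using pos by (simp add: eq zero_le_mult_iff)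
  assume "M \<le> tilted_average p \<epsilon> z w x"
  then have "(LINT h|lborel. ?F h) = 0" using 1 unfolding eq by simp
  then have "AE h in lborel. ?F h = 0"
    using integral_nonneg_eq_0_iff_AE[OF F] nn by simp
  then show "AE h in lborel. ?K h > 0 \<longrightarrow> w (x + \<epsilon> *\<^sub>R h) = M"
    by eventually_elim auto
qed

section \<open>Joint continuity in direction and base point\<close>

text \<open>Off the unit sphere about \<open>a\<close> and the hyperplane through \<open>a\<close>
  orthogonal to \<open>z\<close>, both null sets, lying inside or outside the half ball is stable
  under small changes of direction and centre.\<close>

lemma AE_tilt_kernel_tendsto:
  fixes z a :: "real ^ 'n"
  assumes z: "norm z = 1" and lim: "Z \<longlonglongrightarrow> z" "A \<longlonglongrightarrow> a"
  shows "AE y in lborel. (\<lambda>n. tilt_kernel p (Z n) (y - A n)) \<longlonglongrightarrow> tilt_kernel p z (y - a)"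
proof -
  have "negligible (sphere a 1 \<union> {y. z \<bullet> y = z \<bullet> a})"
    using z by (intro negligible_Un negligible_sphere negligible_hyperplane) auto
  then have "AE y in lebesgue. y \<notin> sphere a 1 \<union> {y. z \<bullet> y = z \<bullet> a}"
    unfolding negligible_iff_null_sets by (rule AE_not_in)
  then have "AE y in lborel. y \<notin> sphere a 1 \<union> {y. z \<bullet> y = z \<bullet> a}"
    by (simp add: AE_completion_iff)
  then show ?thesis
  proof eventually_elim
    fix y assume y: "y \<notin> sphere a 1 \<union> {y. z \<bullet> y = z \<bullet> a}"
    have l1: "(\<lambda>n. norm (y - A n)) \<longlonglongrightarrow> norm (y - a)"
      and l2: "(\<lambda>n. Z n \<bullet> (y - A n)) \<longlonglongrightarrow> z \<bullet> (y - a)"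
      by (intro tendsto_intros lim)+
    have ne: "norm (y - a) \<noteq> 1" "z \<bullet> (y - a) \<noteq> 0"
      using y by (auto simp: dist_norm norm_minus_commute inner_diff_right)
    show "(\<lambda>n. tilt_kernel p (Z n) (y - A n)) \<longlonglongrightarrow> tilt_kernel p z (y - a)"
    proof (cases "norm (y - a) < 1 \<and> 0 < z \<bullet> (y - a)")
      case True
      have "\<forall>\<^sub>F n in sequentially. norm (y - A n) < 1 \<and> 0 < Z n \<bullet> (y - A n)"
        using order_tendstoD(2)[OF l1, of 1] order_tendstoD(1)[OF l2, of 0] True
        by (auto intro: eventually_conj)
      then have "\<forall>\<^sub>F n in sequentially. tilt_kernel p (Z n) (y - A n) = (Z n \<bullet> (y - A n)) powr (p - 2)"
        by eventually_elim (simp add: tilt_kernel_def pos_powr_def)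
      \<comment> \<open>The limit of the base is positive, so the power converges also for a
        negative exponent.\<close>
      moreover have "(\<lambda>n. (Z n \<bullet> (y - A n)) powr (p - 2)) \<longlonglongrightarrow> (z \<bullet> (y - a)) powr (p - 2)"
        using ne by (intro tendsto_powr l2 tendsto_const)
      ultimately show ?thesis
        using True by (simp add: tilt_kernel_def pos_powr_def tendsto_cong)
    next
      case False
      then have "1 < norm (y - a) \<or> z \<bullet> (y - a) < 0" using ne by linarith
      then have "\<forall>\<^sub>F n in sequentially. 1 < norm (y - A n) \<or> Z n \<bullet> (y - A n) < 0"
        using order_tendstoD(1)[OF l1, of 1] order_tendstoD(2)[OF l2, of 0]
        by (auto elim: eventually_mono)
      then have "\<forall>\<^sub>F n in sequentially. tilt_kernel p (Z n) (y - A n) = 0"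
        by eventually_elim (auto simp: tilt_kernel_def pos_powr_def indicator_def)
      moreover have "tilt_kernel p z (y - a) = 0"
        using False by (auto simp: tilt_kernel_def pos_powr_def indicator_def)
      ultimately show ?thesis
        by (simp add: tendsto_eventually)
    qed
  qed
qed

lemma tilt_kernel_shift:
  fixes z a :: "real ^ 'n"
  assumes "norm z = 1" "1 < p"
  shows "integrable lborel (\<lambda>y. tilt_kernel p z (y - a))"
    and "(LINT y|lborel. tilt_kernel p z (y - a)) = (LINT h|lborel. tilt_kernel p z h)"
proof -
  have "integrable (distr lborel borel ((+) (-a))) (tilt_kernel p z)"
    by (simp add: lborel_distr_plus tilt_kernel_integrable assms)
  then show "integrable lborel (\<lambda>y. tilt_kernel p z (y - a))"
    by (subst (asm) integrable_distr_eq) auto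
  have "(LINT h|lborel. tilt_kernel p z h) = (LINT h|distr lborel borel ((+) (-a)). tilt_kernel p z h)"
    by (simp add: lborel_distr_plus)
  also have "\<dots> = (LINT y|lborel. tilt_kernel p z (y - a))"
    by (subst integral_distr) auto
  finally show "(LINT y|lborel. tilt_kernel p z (y - a)) = (LINT h|lborel. tilt_kernel p z h)" by simp
qed

text \<open>Since the kernels have the same mass in every direction, Scheffe's lemma upgrades their
  almost everywhere convergence to convergence in $L^1$.\<close>
lemma tilt_kernel_tendsto_L1:
  fixes z a :: "real ^ 'n"
  assumes z: "norm z = 1" "\<And>n. norm (Z n) = 1" and p: "1 < p"
    and lim: "Z \<longlonglongrightarrow> z" "A \<longlonglongrightarrow> a"
  shows "(\<lambda>n. LINT y|lborel. \<bar>tilt_kernel p (Z n) (y - A n) - tilt_kernel p z (y - a)\<bar>) \<longlonglongrightarrow> 0"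
proof -
  let ?F = "\<lambda>n y. tilt_kernel p (Z n) (y - A n)" and ?f = "\<lambda>y. tilt_kernel p z (y - a)"
  note iF = tilt_kernel_shift(1)[OF z(2) p] and i_f = tilt_kernel_shift(1)[OF z(1) p]
  have mass: "(\<integral>\<^sup>+ y. norm (tilt_kernel p z' (y - b)) \<partial>lborel) = ennreal (LINT h|lborel. tilt_kernel p z h)"
    if "norm z' = 1" for z' b :: "real ^ 'n"
  proof -
    have "(\<integral>\<^sup>+ y. norm (tilt_kernel p z' (y - b)) \<partial>lborel) = ennreal (LINT y|lborel. tilt_kernel p z' (y - b))"
      using tilt_kernel_shift(1)[OF that p, of b]
      by (subst nn_integral_eq_integral[symmetric]) (auto simp: tilt_kernel_nonneg)
    then show ?thesis
      using tilt_kernel_shift(2)[OF that p, of b] tilt_kernel_integral_indep[OF that z(1)] by simp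
  qed
  have "(\<lambda>n. \<integral>\<^sup>+ y. norm (?F n y - ?f y) \<partial>lborel) \<longlonglongrightarrow> 0"
    by (rule Scheffe_lemma2)
      (simp_all only: mass[OF z(1)] mass[OF z(2)] iF i_f order_refl
        borel_measurable_integrable AE_tilt_kernel_tendsto[OF z(1) lim])
  moreover have "(\<integral>\<^sup>+ y. norm (?F n y - ?f y) \<partial>lborel) = ennreal (LINT y|lborel. \<bar>?F n y - ?f y\<bar>)" for n
    by (subst nn_integral_eq_integral) (auto intro!: integrable_norm iF i_f simp flip: real_norm_def)
  ultimately show ?thesis
    by (simp add: ennreal_tendsto_0_iff)
qed

text \<open>Since \<open>w\<close> is only bounded and measurable, continuity must come from the
  kernel. A translation moves the base point from \<open>w\<close> into the kernel, and the
  integrals then differ by at most \<open>B\<close> times the L1 distance of the kernels.\<close>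

lemma continuous_on_tilted_average:
  fixes w :: "real ^ 'n \<Rightarrow> real"
  assumes w: "w \<in> borel_measurable borel" "\<And>y. \<bar>w y\<bar> \<le> B" and p: "1 < p" and \<epsilon>: "0 < \<epsilon>"
  shows "continuous_on ({z. norm z = 1} \<times> X) (\<lambda>(z, x). tilted_average p \<epsilon> z w x)"
proof (rule continuous_on_sequentiallyI)
  fix s :: "nat \<Rightarrow> (real ^ 'n) \<times> (real ^ 'n)" and q
  assume s: "\<forall>n. s n \<in> {z. norm z = 1} \<times> X" and q: "q \<in> {z. norm z = 1} \<times> X" and lim: "s \<longlonglongrightarrow> q"
  \<comment> \<open>Base points are divided by \<open>\<epsilon>\<close> because
    \<open>x + \<epsilon> h = \<epsilon> (x / \<epsilon> + h)\<close>: the kernel gets shifted by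
    \<open>x / \<epsilon>\<close>.\<close>
  define Z A where "Z n = fst (s n)" and "A n = snd (s n) /\<^sub>R \<epsilon>" for n
  define z a where "z = fst q" and "a = snd q /\<^sub>R \<epsilon>"
  have z: "norm z = 1" and Z: "norm (Z n) = 1" for n
    using q s by (auto simp: z_def Z_def mem_Times_iff)
  have Zl: "Z \<longlonglongrightarrow> z" and Al: "A \<longlonglongrightarrow> a"
    unfolding Z_def z_def A_def a_def by (intro tendsto_intros lim)+
  have conv: "(LINT h|lborel. w (\<epsilon> *\<^sub>R b + \<epsilon> *\<^sub>R h) * tilt_kernel p y h)
      = (LINT h|lborel. w (\<epsilon> *\<^sub>R h) * tilt_kernel p y (h - b))" (is "?l = ?r") for b y
  proof -
    have "?r = (LINT h|distr lborel borel ((+) b). w (\<epsilon> *\<^sub>R h) * tilt_kernel p y (h - b))"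
      by (simp add: lborel_distr_plus)
    also have "\<dots> = ?l"
      using w(1) by (subst integral_distr) (auto simp: scaleR_add_right)
    finally show ?thesis by simp
  qed
  have int: "integrable lborel (\<lambda>h. w (\<epsilon> *\<^sub>R h) * tilt_kernel p y (h - b))" if "norm y = 1" for y b
    by (rule integrable_bounded_mult[where B = B])
      (use w tilt_kernel_shift(1)[OF that p] in simp_all)
  let ?I = "\<lambda>y b. LINT h|lborel. w (\<epsilon> *\<^sub>R h) * tilt_kernel p y (h - b)"
  let ?D = "\<lambda>n. LINT y|lborel. \<bar>tilt_kernel p (Z n) (y - A n) - tilt_kernel p z (y - a)\<bar>"
  have bound: "norm (?I (Z n) (A n) - ?I z a) \<le> B * ?D n" for n
  proof -
    have iD: "integrable lborel (\<lambda>y. \<bar>tilt_kernel p (Z n) (y - A n) - tilt_kernel p z (y - a)\<bar>)"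
      by (intro integrable_abs Bochner_Integration.integrable_diff tilt_kernel_shift z Z p)
    have "?I (Z n) (A n) - ?I z a
        = (LINT h|lborel. w (\<epsilon> *\<^sub>R h) * (tilt_kernel p (Z n) (h - A n) - tilt_kernel p z (h - a)))"
      using int[OF Z] int[OF z] by (simp add: right_diff_distrib)
    also have "norm \<dots> \<le> (LINT h|lborel. norm (w (\<epsilon> *\<^sub>R h) * (tilt_kernel p (Z n) (h - A n) - tilt_kernel p z (h - a))))"
      by (rule integral_norm_bound)
    also have "\<dots> \<le> (LINT h|lborel. B * \<bar>tilt_kernel p (Z n) (h - A n) - tilt_kernel p z (h - a)\<bar>)"
    proof (rule integral_mono)
      show "integrable lborel (\<lambda>h. norm (w (\<epsilon> *\<^sub>R h) * (tilt_kernel p (Z n) (h - A n) - tilt_kernel p z (h - a))))"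
        unfolding right_diff_distrib
        by (intro integrable_norm Bochner_Integration.integrable_diff int z Z)
      show "integrable lborel (\<lambda>h. B * \<bar>tilt_kernel p (Z n) (h - A n) - tilt_kernel p z (h - a)\<bar>)"
        using iD by simp
    qed (auto simp: abs_mult intro!: mult_right_mono w(2))
    also have "\<dots> = B * ?D n" by simp
    finally show ?thesis .
  qed
  have "(\<lambda>n. B * ?D n) \<longlonglongrightarrow> 0"
    using tendsto_mult_right_zero[OF tilt_kernel_tendsto_L1[OF z Z p Zl Al]] .
  then have "(\<lambda>n. ?I (Z n) (A n) - ?I z a) \<longlonglongrightarrow> 0"
    by (rule Lim_null_comparison[OF always_eventually[OF allI[OF bound]]])
  then have I: "(\<lambda>n. ?I (Z n) (A n)) \<longlonglongrightarrow> ?I z a"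
    by (rule LIM_zero_cancel)
  have ta: "tilted_average p \<epsilon> y w (\<epsilon> *\<^sub>R b) = ?I y b / (LINT h|lborel. tilt_kernel p z h)"
    if "norm y = 1" for y b
    using tilt_kernel_integral_indep[OF that z] by (simp add: tilted_average_eq conv)
  have "(\<lambda>n. tilted_average p \<epsilon> (Z n) w (\<epsilon> *\<^sub>R A n)) \<longlonglongrightarrow> tilted_average p \<epsilon> z w (\<epsilon> *\<^sub>R a)"
    unfolding ta[OF z] ta[OF Z]
    using tilt_kernel_integral_pos[OF z p] by (intro tendsto_divide I tendsto_const) auto
  then show "(\<lambda>n. (\<lambda>(z, x). tilted_average p \<epsilon> z w x) (s n)) \<longlonglongrightarrow> (\<lambda>(z, x). tilted_average p \<epsilon> z w x) q"
    using \<epsilon> by (simp add: Z_def z_def A_def a_def case_prod_unfold)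
qed

section \<open>Extremal directions\<close>

lemma compact_unit_vectors: "compact {z :: 'a::euclidean_space. norm z = 1}"
  using compact_sphere[of "0 :: 'a" 1] by (simp add: sphere_def)

lemma unit_vectors_nonempty: "{z :: 'a::euclidean_space. norm z = 1} \<noteq> {}"
  using vector_choose_size[of 1, where 'a = 'a] by auto

lemma tilted_average_attains_extrema:
  fixes w :: "real ^ 'n \<Rightarrow> real"
  assumes "w \<in> borel_measurable borel" "\<And>y. \<bar>w y\<bar> \<le> B" "1 < p" "0 < \<epsilon>"
  obtains zmax zmin where "norm zmax = 1" "norm zmin = 1"
    and "(SUP z\<in>{z. norm z = 1}. tilted_average p \<epsilon> z w x) = tilted_average p \<epsilon> zmax w x"
    and "(INF z\<in>{z. norm z = 1}. tilted_average p \<epsilon> z w x) = tilted_average p \<epsilon> zmin w x"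
    and "\<And>z. norm z = 1 \<Longrightarrow> tilted_average p \<epsilon> z w x \<le> tilted_average p \<epsilon> zmax w x"
    and "\<And>z. norm z = 1 \<Longrightarrow> tilted_average p \<epsilon> zmin w x \<le> tilted_average p \<epsilon> z w x"
proof -
  let ?Z = "{z :: real ^ 'n. norm z = 1}"
  have Z: "compact ?Z" "?Z \<noteq> {}"
    by (rule compact_unit_vectors unit_vectors_nonempty)+
  have cont: "continuous_on ?Z (\<lambda>z. tilted_average p \<epsilon> z w x)"
    using continuous_on_compose2[OF continuous_on_tilted_average[OF assms, where X = UNIV], of ?Z "\<lambda>z. (z, x)"]
    by (simp add: continuous_on_Pair image_subset_iff)
  obtain zmax where 1: "zmax \<in> ?Z" "\<forall>z\<in>?Z. tilted_average p \<epsilon> z w x \<le> tilted_average p \<epsilon> zmax w x"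
    using continuous_attains_sup[OF Z cont] by blast
  obtain zmin where 2: "zmin \<in> ?Z" "\<forall>z\<in>?Z. tilted_average p \<epsilon> zmin w x \<le> tilted_average p \<epsilon> z w x"
    using continuous_attains_inf[OF Z cont] by blast
  show thesis
  proof (rule that[of zmax zmin])
    show "(SUP z\<in>?Z. tilted_average p \<epsilon> z w x) = tilted_average p \<epsilon> zmax w x"
      using 1 by (intro cSup_eq_maximum) auto
    show "(INF z\<in>?Z. tilted_average p \<epsilon> z w x) = tilted_average p \<epsilon> zmin w x"
      using 2 by (intro cInf_eq_minimum) auto
  qed (use 1 2 in auto)
qed

section \<open>Comparison for bounded Borel functions on the whole space\<close>

lemma comparison_of_bounded_borel:
  fixes \<Omega> :: "(real ^ 'n) set" and u v :: "real ^ 'n \<Rightarrow> real"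
  assumes p: "1 < p" and \<epsilon>: "0 < \<epsilon>" and \<Omega>: "\<Omega> \<noteq> {}" "bounded \<Omega>"
    and u: "u \<in> borel_measurable borel" "\<And>y. \<bar>u y\<bar> \<le> B"
    and v: "v \<in> borel_measurable borel" "\<And>y. \<bar>v y\<bar> \<le> B"
    and dpp: "solves_dpp p \<epsilon> \<Omega> f u" "solves_dpp p \<epsilon> \<Omega> f v"
    and bdry: "\<forall>x \<in> eps_nbhd \<epsilon> \<Omega> - \<Omega>. u x \<le> v x"
  shows "\<forall>x \<in> \<Omega>. u x \<le> v x"
proof (rule ccontr)
  assume "\<not> (\<forall>x \<in> \<Omega>. u x \<le> v x)"
  then obtain y0 where y0: "y0 \<in> \<Omega>" "v y0 < u y0" by (auto simp: not_le)
  let ?Z = "{z :: real ^ 'n. norm z = 1}"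
  have Z: "compact ?Z" "?Z \<noteq> {}"
    by (rule compact_unit_vectors unit_vectors_nonempty)+
  define X where "X = closure \<Omega>"
  have X: "compact X" "X \<noteq> {}" "\<Omega> \<subseteq> X"
    using \<Omega> by (auto simp: X_def closure_subset compact_closure closure_eq_empty)
  define T where "T w z x = tilted_average p \<epsilon> z w x" for w and z x :: "real ^ 'n"
  define S where "S w x = (SUP z\<in>?Z. T w z x)" for w and x :: "real ^ 'n"
  define I where "I w x = (INF z\<in>?Z. T w z x)" for w and x :: "real ^ 'n"
  \<comment> \<open>This is the difference of the two right-hand sides, with the \<open>f\<close>
    terms cancelled. It agrees with \<open>u - v\<close> on \<open>\<Omega>\<close> but is
    continuous on all of the closure.\<close>
  define W where "W x = 1 / 2 * (S u x - S v x + (I u x - I v x))" for x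
  have cT: "continuous_on (?Z \<times> X) (\<lambda>(z, x). T u z x)" "continuous_on (?Z \<times> X) (\<lambda>(z, x). T v z x)"
    unfolding T_def by (rule continuous_on_tilted_average u v p \<epsilon>)+
  have cW: "continuous_on X W"
    unfolding W_def S_def I_def
    by (intro continuous_intros continuous_on_SUP_compact continuous_on_INF_compact Z X cT)
  have W: "u x - v x = W x" if "x \<in> \<Omega>" for x
    using dpp[unfolded solves_dpp_def, THEN bspec, OF that]
    unfolding W_def S_def I_def T_def by argo
  obtain x0 where x0: "x0 \<in> X" "\<forall>y\<in>X. W y \<le> W x0"
    using continuous_attains_sup[OF X(1,2) cW] by blast
  define M where "M = W x0"
  have w_le_\<Omega>: "u y - v y \<le> M" if "y \<in> \<Omega>" for y
    using W[OF that] x0(2) X(3) that by (simp add: M_def subset_iff)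
  have M: "0 < M"
    using w_le_\<Omega>[OF y0(1)] y0(2) by linarith
  have off: "u y - v y \<le> 0" if "y \<in> eps_nbhd \<epsilon> \<Omega>" "y \<notin> \<Omega>" for y
    using bdry that by simp
  have w_le: "u y - v y \<le> M" if "y \<in> eps_nbhd \<epsilon> \<Omega>" for y
    using off[OF that] w_le_\<Omega>[of y] M by linarith
  \<comment> \<open>Here \<open>0 < M\<close> is decisive: in the part of the neighbourhood outside
    \<open>\<Omega>\<close> the difference is at most 0, so it cannot equal
    \<open>M\<close>.\<close>
  have w_eq: "y \<in> \<Omega>" if "y \<in> eps_nbhd \<epsilon> \<Omega>" "u y - v y = M" for y
    using off[OF that(1)] that(2) M by linarith
  \<comment> \<open>The maximum of \<open>W\<close> may sit on the boundary of
    \<open>\<Omega>\<close>, so closure points are covered too: their distance to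
    \<open>\<Omega>\<close> is 0 and the displacement is shorter than
    \<open>\<epsilon>\<close>.\<close>
  have near: "x + \<epsilon> *\<^sub>R h \<in> eps_nbhd \<epsilon> \<Omega>" if "x \<in> X" "norm h < 1" for x h
  proof -
    have "infdist (x + \<epsilon> *\<^sub>R h) \<Omega> \<le> infdist x \<Omega> + dist (x + \<epsilon> *\<^sub>R h) x"
      by (rule infdist_triangle)
    also have "infdist x \<Omega> = 0"
      using that(1) \<Omega>(1) by (simp add: X_def in_closure_iff_infdist_zero)
    also have "0 + dist (x + \<epsilon> *\<^sub>R h) x < \<epsilon>"
      using that(2) \<epsilon> by (simp add: dist_norm)
    finally show ?thesis by (simp add: eps_nbhd_def)
  qed
  define E where "E = {x \<in> X. W x = M}"
  have "closed E"
    unfolding E_def by (rule continuous_closed_preimage_constant[OF cW compact_imp_closed[OF X(1)]])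
  then have E: "compact E" "E \<noteq> {}"
    using X(1) x0 by (auto simp: E_def M_def compact_eq_bounded_closed intro: bounded_subset)
  \<comment> \<open>Any unit vector serves as \<open>e\<close>; compactness of the set
    \<open>E\<close> of maximum points gives one that lies farthest in this direction.\<close>
  obtain e :: "real ^ 'n" where e: "norm e = 1" using Z(2) by blast
  have "continuous_on E (\<lambda>x. e \<bullet> x)" by (intro continuous_intros)
  then obtain x where x: "x \<in> E" and extreme: "\<forall>y\<in>E. e \<bullet> y \<le> e \<bullet> x"
    using continuous_attains_sup[OF E] by blast
  have xX: "x \<in> X" and Wx: "W x = M" using x by (auto simp: E_def)
  let ?w = "\<lambda>y. u y - v y"
  have w: "?w \<in> borel_measurable borel" "\<And>y. \<bar>?w y\<bar> \<le> 2 * B"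
  proof -
    show "?w \<in> borel_measurable borel" using u(1) v(1) by simp
    show "\<bar>?w y\<bar> \<le> 2 * B" for y using u(2)[of y] v(2)[of y] by linarith
  qed
  have Tw: "T ?w z x = T u z x - T v z x" if "norm z = 1" for z
    unfolding T_def by (rule tilted_average_diff[OF u v that p])
  have T_le: "T u z x - T v z x \<le> M" if "norm z = 1" for z
    using tilted_average_le(1)[OF w that p, of x \<epsilon> M] w_le near[OF xX] Tw[OF that]
    by (simp add: T_def)
  \<comment> \<open>The hypothesis \<open>ge\<close> is the equality case of the mean bound. Unless
    \<open>z = - e\<close>, it produces a point of \<open>E\<close> strictly beyond \<open>x\<close>
    in direction \<open>e\<close>.\<close>
  have outward: "z = - e" if z: "norm z = 1" and ge: "M \<le> T u z x - T v z x" for z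
  proof (rule ccontr)
    assume ne: "z \<noteq> - e"
    have "AE h in lborel. tilt_kernel p z h > 0 \<longrightarrow> ?w (x + \<epsilon> *\<^sub>R h) = M"
      using w_le near[OF xX] ge Tw[OF z]
      by (intro tilted_average_le(2)[OF w z p]) (auto simp: T_def)
    from AE_tilt_kernel_imp_ex[OF this z e ne]
    obtain h where h: "norm h < 1" "0 < e \<bullet> h" "?w (x + \<epsilon> *\<^sub>R h) = M" by blast
    have "x + \<epsilon> *\<^sub>R h \<in> \<Omega>" using w_eq near[OF xX] h by blast
    then have "x + \<epsilon> *\<^sub>R h \<in> E" using h(3) W X(3) by (auto simp: E_def)
    then have "e \<bullet> (x + \<epsilon> *\<^sub>R h) \<le> e \<bullet> x" using extreme by blast
    then show False using h(2) \<epsilon> by (simp add: inner_add_right mult_le_0_iff)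
  qed
  obtain a b where a: "norm a = 1" "S u x = T u a x" "\<And>z. norm z = 1 \<Longrightarrow> T u z x \<le> T u a x"
    and b: "norm b = 1" "I u x = T u b x" "\<And>z. norm z = 1 \<Longrightarrow> T u b x \<le> T u z x"
    unfolding T_def S_def I_def
    by (rule tilted_average_attains_extrema[OF u p \<epsilon>, of x]) blast
  obtain c d where c: "norm c = 1" "S v x = T v c x" "\<And>z. norm z = 1 \<Longrightarrow> T v z x \<le> T v c x"
    and d: "norm d = 1" "I v x = T v d x" "\<And>z. norm z = 1 \<Longrightarrow> T v d x \<le> T v z x"
    unfolding T_def S_def I_def
    by (rule tilted_average_attains_extrema[OF v p \<epsilon>, of x]) blast
  \<comment> \<open>Testing \<open>v\<close> in direction \<open>a\<close> bounds the difference of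
    suprema by \<open>M\<close>, and testing \<open>u\<close> in direction \<open>d\<close> bounds
    that of infima. Their mean is \<open>W x = M\<close>, so both bounds are equalities.\<close>
  have eqs: "S u x - S v x = M" "I u x - I v x = M"
    using T_le[OF a(1)] T_le[OF d(1)] c(3)[OF a(1)] b(3)[OF d(1)] a(2) b(2) c(2) d(2) Wx
    by (simp_all add: W_def)
  \<comment> \<open>For a maximising direction \<open>z\<close> of \<open>u\<close>, the difference
    of averages is at least \<open>S u x - S v x = M\<close>.\<close>
  have u_max: "z = - e" if "norm z = 1" "S u x \<le> T u z x" for z
    using outward[OF that(1)] c(3)[OF that(1)] that(2) c(2) eqs by linarith
  have "a = - e" using u_max[OF a(1)] a(2) by simp
  moreover have "d = - e" using outward[OF d(1)] b(3)[OF d(1)] b(2) d(2) eqs by linarith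
  \<comment> \<open>As \<open>a = d\<close>, the bound by \<open>M\<close> in this direction reads
    \<open>S u x - I v x \<le> M = I u x - I v x\<close>. Hence all averages of \<open>u\<close> at
    \<open>x\<close> coincide and \<open>e\<close> is maximising as well.\<close>
  ultimately have "S u x \<le> I u x"
    using T_le[OF a(1)] a(2) d(2) eqs by simp
  then have "e = - e"
    using u_max[OF e] b(3)[OF e] b(2) by simp
  then have "e \<bullet> e = - (e \<bullet> e)" by (metis inner_minus_right)
  then show False using e by (simp add: dot_square_norm)
qed

section \<open>Passage from the neighbourhood to the whole space\<close>

theorem theorem3p8:
  fixes \<Omega> :: "(real ^ 'n) set"
    and f u v :: "real ^ 'n \<Rightarrow> real"
    and p \<epsilon> :: real
  assumes "1 < p"
    and "0 < \<epsilon>"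
    and "\<Omega> \<noteq> {}" "open \<Omega>" "connected \<Omega>" "bounded \<Omega>"
    and "bounded_borel_on \<Omega> f"
    and "bounded_borel_on (eps_nbhd \<epsilon> \<Omega>) u"
    and "bounded_borel_on (eps_nbhd \<epsilon> \<Omega>) v"
    and "solves_dpp p \<epsilon> \<Omega> f u"
    and "solves_dpp p \<epsilon> \<Omega> f v"
    and "\<forall>x \<in> eps_nbhd \<epsilon> \<Omega> - \<Omega>. u x \<le> v x"
  shows "\<forall>x \<in> \<Omega>. u x \<le> v x"
proof -
  let ?N = "eps_nbhd \<epsilon> \<Omega>"
  \<comment> \<open>Extension by zero is Borel on the whole space because the neighbourhood is open,
    hence a Borel set.\<close>
  define ext where "ext w y = indicator ?N y * w y" for w :: "real ^ 'n \<Rightarrow> real" and y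
  have "open ?N"
    unfolding eps_nbhd_def by (intro open_Collect_less continuous_intros)
  then have N: "?N \<in> sets borel" by simp
  have ext_eq: "ext w y = w y" if "y \<in> ?N" for w y
    using that by (simp add: ext_def)
  have sub: "\<Omega> \<subseteq> ?N"
    using \<open>0 < \<epsilon>\<close> by (auto simp: eps_nbhd_def)
  have ext_meas: "ext w \<in> borel_measurable borel" if "bounded_borel_on ?N w" for w
    using that N unfolding bounded_borel_on_def ext_def
    by (subst (asm) borel_measurable_restrict_space_iff) auto
  have ext_bound: "\<exists>B. \<forall>y. \<bar>ext w y\<bar> \<le> B" if "bounded_borel_on ?N w" for w
  proof -
    from that obtain B where "\<forall>r\<in>w ` ?N. norm r \<le> B"
      unfolding bounded_borel_on_def bounded_iff by blast
    then have "\<bar>ext w y\<bar> \<le> max B 0" for y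
      by (auto simp: ext_def indicator_def le_max_iff_disj)
    then show ?thesis by blast
  qed
  \<comment> \<open>For \<open>x\<close> in \<open>\<Omega>\<close> the averages see only the open
    ball of radius \<open>\<epsilon>\<close> about \<open>x\<close>, which lies in the
    neighbourhood, where nothing was changed.\<close>
  have ext_dpp: "solves_dpp p \<epsilon> \<Omega> f (ext w)" if "solves_dpp p \<epsilon> \<Omega> f w" for w
  proof -
    have "tilted_average p \<epsilon> z (ext w) x = tilted_average p \<epsilon> z w x" if "x \<in> \<Omega>" for x z
    proof (rule tilted_average_cong, rule ext_eq)
      fix h :: "real ^ 'n" assume "norm h < 1"
      then have "dist (x + \<epsilon> *\<^sub>R h) x < \<epsilon>" using \<open>0 < \<epsilon>\<close> by (simp add: dist_norm)
      then show "x + \<epsilon> *\<^sub>R h \<in> ?N"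
        using infdist_le[OF that, of "x + \<epsilon> *\<^sub>R h"] by (simp add: eps_nbhd_def)
    qed
    then show ?thesis
      using that sub ext_eq[of _ w] by (auto simp: solves_dpp_def)
  qed
  obtain Bu Bv where B: "\<And>y. \<bar>ext u y\<bar> \<le> Bu" "\<And>y. \<bar>ext v y\<bar> \<le> Bv"
    using ext_bound assms(8,9) by metis
  have "\<forall>x \<in> \<Omega>. ext u x \<le> ext v x"
  proof (rule comparison_of_bounded_borel[OF assms(1-3,6) ext_meas[OF assms(8)] _ ext_meas[OF assms(9)] _
        ext_dpp[OF assms(10)] ext_dpp[OF assms(11)]])
    show "\<bar>ext u y\<bar> \<le> max Bu Bv" "\<bar>ext v y\<bar> \<le> max Bu Bv" for y
      using B[of y] by linarith+
    show "\<forall>x \<in> ?N - \<Omega>. ext u x \<le> ext v x"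
      using assms(12) by (simp add: ext_eq)
  qed
  then have "u x \<le> v x" if "x \<in> \<Omega>" for x
    using ext_eq[OF subsetD[OF sub that], of u] ext_eq[OF subsetD[OF sub that], of v] that by metis
  then show ?thesis by blast
qed

end
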